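(* Let $V>0$ be an integer with $2^V\le N$ and let $s>0$. For every online learning algorithm for the prediction with expert advice problem with $N$ experts and $T$ rounds, there exists a sequence of loss vectors $\boldsymbol{l}_1,\dots,\boldsymbol{l}_T\in\{0,\pm s\}^N$ with $\operatorname{rank}([\boldsymbol{l}_1,\dots,\boldsymbol{l}_T])=V$ and $\|\boldsymbol{l}_t\|_0=2^V$ for all $t\in\{1,\dots,T\}$, such that $$\mathrm{Regret}_T\ge2s\sqrt{\frac{VT}{8}}.$$
   Context: Prediction with expert advice: in each round $t=1,\dots,T$ the learner plays $\mathbf{p}_t\in\Delta_N=\{\mathbf{x}\in[0,1]^N:\sum_ix_i=1\}$, then the loss vector $\boldsymbol{l}_t\in\mathbb{R}^N$ is revealed and the learner suffers $\mathbf{p}_t\cdot\boldsymbol{l}_t$. An online learning algorithm is a rule choosing each $\mathbf{p}_t$ as a function of $\boldsymbol{l}_1,\dots,\boldsymbol{l}_{t-1}$. The regret is $\mathrm{Regret}_T=\sum_{t=1}^T\mathbf{p}_t\cdot\boldsymbol{l}_t-\min_{i\in\{1,\dots,N\}}\sum_{t=1}^T l_t(i)$. $\|\mathbf{x}\|_0$ denotes the number of nonzero coordinates of $\mathbf{x}$, and $[\boldsymbol{l}_1,\dots,\boldsymbol{l}_T]$ is the $N\times T$ matrix with columns $\boldsymbol{l}_t$.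
   Formalization: The number of rounds is assumed to satisfy T ≥ V; for T < V the N×T loss matrix has rank at most T < V, so no loss sequence of rank V exists and the statement fails as written. *)

theory Defs
  imports Complex_Main "Jordan_Normal_Form.DL_Rank"
begin

(* Experts are the indices 0, ..., N - 1; rounds are 1, ..., T.  A loss sequence is a function
   l :: nat => real vec of which only the values l 1, ..., l T matter. *)

definition prob_simplex :: "nat \<Rightarrow> real vec set" where
  "prob_simplex N =
     {x \<in> carrier_vec N. (\<forall>i<N. 0 \<le> x $ i \<and> x $ i \<le> 1) \<and> (\<Sum>i<N. x $ i) = 1}"

(* The algorithm maps the list of past losses, oldest first, to the next play; it may depend
   on N and T. *)
definition online_algorithm :: "nat \<Rightarrow> nat \<Rightarrow> (real vec list \<Rightarrow> real vec) \<Rightarrow> bool" where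
  "online_algorithm N T alg \<longleftrightarrow>
     (\<forall>ls. length ls < T \<and> set ls \<subseteq> carrier_vec N \<longrightarrow> alg ls \<in> prob_simplex N)"

definition play :: "(real vec list \<Rightarrow> real vec) \<Rightarrow> (nat \<Rightarrow> real vec) \<Rightarrow> nat \<Rightarrow> real vec" where
  "play alg l t = alg (map l [1..<t])"

definition regret :: "nat \<Rightarrow> nat \<Rightarrow> (real vec list \<Rightarrow> real vec) \<Rightarrow> (nat \<Rightarrow> real vec) \<Rightarrow> real" where
  "regret N T alg l =
     (\<Sum>t=1..T. play alg l t \<bullet> l t) - (MIN i\<in>{..<N}. \<Sum>t=1..T. l t $ i)"

definition norm0 :: "real vec \<Rightarrow> nat" where
  "norm0 x = card {i. i < dim_vec x \<and> x $ i \<noteq> 0}"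

definition loss_matrix :: "nat \<Rightarrow> nat \<Rightarrow> (nat \<Rightarrow> real vec) \<Rightarrow> real mat" where
  "loss_matrix N T l = mat_of_cols N (map l [1..<Suc T])"

end

(* Index the first 2^V experts by their V bits.  In round u + 1 the adversary plays, up to sign,
   s times the vector x_j with j = u mod V, whose entry at expert i is -1 or 1 according to bit j
   of i.  If S_j is the sum of the signs used for x_j, the expert whose bits match the signs of
   the S_j has total loss -s * (sum of the |S_j|).  For random signs the learner's expected loss
   is 0, so the expected regret is s times the sum of the means E|S_j|; instead of averaging, the
   signs are chosen greedily from the conditional expectations.  Finally E|S| >= sqrt (n / 2) for
   a sum S of n random signs. *)

theory Submission
  imports Defs
begin

section \<open>The simple random walk and its mean absolute value\<close>

text \<open>The probability that the walk from 0 is at \<open>c\<close> after \<open>n\<close>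
  steps; by symmetry also that the walk from \<open>c\<close> is then at 0.\<close>

primrec walk_prob :: "nat \<Rightarrow> int \<Rightarrow> real" where
  "walk_prob 0 c = (if c = 0 then 1 else 0)"
| "walk_prob (Suc n) c = (walk_prob n (c + 1) + walk_prob n (c - 1)) / 2"

text \<open>The mean of \<open>\<bar>c + S\<^sub>n\<bar>\<close> for the simple random walk \<open>S\<close>, in Tanaka's form:
  \<open>\<bar>c\<bar>\<close> plus the expected number of visits to 0 before time \<open>n\<close>.\<close>

definition walk_abs_mean :: "nat \<Rightarrow> int \<Rightarrow> real" where
  "walk_abs_mean n c = \<bar>real_of_int c\<bar> + (\<Sum>k<n. walk_prob k c)"

lemma walk_abs_mean_0 [simp]: "walk_abs_mean 0 c = \<bar>real_of_int c\<bar>"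
  by (simp add: walk_abs_mean_def)

text \<open>Averaging the absolute value over the two neighbours of \<open>c\<close> gains 1 at
  \<open>c = 0\<close> and nothing elsewhere; this gain is the visit to 0 at time 0.\<close>

lemma walk_abs_mean_Suc:
  "walk_abs_mean (Suc n) c = (walk_abs_mean n (c + 1) + walk_abs_mean n (c - 1)) / 2"
proof -
  have "(\<Sum>k<Suc n. walk_prob k c) = walk_prob 0 c + (\<Sum>k<n. walk_prob (Suc k) c)"
    by (rule sum.lessThan_Suc_shift)
  also have "(\<Sum>k<n. walk_prob (Suc k) c)
      = ((\<Sum>k<n. walk_prob k (c + 1)) + (\<Sum>k<n. walk_prob k (c - 1))) / 2"
    by (simp add: sum.distrib flip: sum_divide_distrib)
  finally have *: "(\<Sum>k<Suc n. walk_prob k c)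
      = walk_prob 0 c + ((\<Sum>k<n. walk_prob k (c + 1)) + (\<Sum>k<n. walk_prob k (c - 1))) / 2" .
  have "2 * \<bar>real_of_int c\<bar> + 2 * walk_prob 0 c
      = \<bar>real_of_int (c + 1)\<bar> + \<bar>real_of_int (c - 1)\<bar>"
    by (cases c "0 :: int" rule: linorder_cases) auto
  then show ?thesis
    unfolding walk_abs_mean_def * by (simp add: field_simps)
qed

lemma walk_prob_eq_0_if_gt: "c > int n \<Longrightarrow> walk_prob n c = 0"
  by (induction n arbitrary: c) auto

lemma walk_prob_eq_0_if_odd: "odd (int n + c) \<Longrightarrow> walk_prob n c = 0"
  by (induction n arbitrary: c) auto

text \<open>Exactly \<open>k\<close> of the \<open>n\<close> steps go down, and the recursion of the
  walk becomes Pascal's rule.\<close>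

lemma walk_prob_binomial: "walk_prob n (int n - 2 * int k) = (n choose k) / 2 ^ n"
proof (induction n arbitrary: k)
  case 0
  then show ?case by (cases k) auto
next
  case (Suc n)
  have 1: "walk_prob n (int n - 2 * int k) = (n choose k) / 2 ^ n"
    by (rule Suc)
  show ?case
  proof (cases k)
    case 0
    \<comment> \<open>The neighbour \<open>n + 2\<close> is out of reach in \<open>n\<close>
      steps.\<close>
    with 1 show ?thesis by (simp add: walk_prob_eq_0_if_gt)
  next
    case (Suc k')
    have "walk_prob n (int n - 2 * int k') = (n choose k') / 2 ^ n"
      by (rule Suc.IH)
    with 1 Suc show ?thesis by (simp add: field_simps)
  qed
qed

lemma walk_prob_even_0: "walk_prob (2 * m) 0 = ((2 * m) choose m) / 4 ^ m"
  using walk_prob_binomial[of "2 * m" m] by (simp add: power_mult)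

lemma walk_prob_Suc_even_0: "walk_prob (Suc (2 * m)) 0 = 0"
  by (rule walk_prob_eq_0_if_odd) simp

text \<open>Both rows are compared with row 2m + 1, whose two middle entries are equal.\<close>

lemma central_binomial_Suc:
  "Suc m * ((2 * Suc m) choose (Suc m)) = 2 * (2 * m + 1) * ((2 * m) choose m)"
proof -
  have sym: "(Suc (2 * m)) choose m = (Suc (2 * m)) choose (Suc m)"
    using binomial_symmetric[of m "Suc (2 * m)"] by simp
  have "((2 * Suc m) choose (Suc m)) = 2 * (Suc (2 * m) choose Suc m)"
    using sym by simp
  moreover have "Suc (2 * m) * ((2 * m) choose m) = (Suc (2 * m) choose Suc m) * Suc m"
    by (rule Suc_times_binomial_eq)
  ultimately show ?thesis by (simp only: mult.assoc mult.left_commute) simp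
qed

lemma walk_prob_even_0_Suc:
  "real (2 * m + 2) * walk_prob (2 * Suc m) 0 = real (2 * m + 1) * walk_prob (2 * m) 0"
proof -
  have "real (Suc m) * real ((2 * Suc m) choose (Suc m))
      = 2 * real (2 * m + 1) * real ((2 * m) choose m)"
    using arg_cong[OF central_binomial_Suc, of real] by (simp only: of_nat_mult of_nat_numeral)
  moreover have "real (2 * m + 2) * (A / 4 ^ Suc m) = real (2 * m + 1) * (B / 4 ^ m)"
    if "real (Suc m) * A = 2 * real (2 * m + 1) * B" for A B
  proof -
    have "real (2 * m + 2) * (A / 4 ^ Suc m) = real (Suc m) * A / (2 * 4 ^ m)"
      by (simp add: field_simps)
    then show ?thesis unfolding that by (simp add: field_simps)
  qed
  ultimately show ?thesis
    unfolding walk_prob_even_0 by blast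
qed

text \<open>The sum of return probabilities p(m) at times 2m telescopes: (2m + 1) p(m) = (2m + 2)
  p(m + 1) absorbs the next term p(m + 1), and odd times contribute nothing.\<close>

lemma walk_abs_mean_odd: "walk_abs_mean (2 * m + 1) 0 = real (2 * m + 1) * walk_prob (2 * m) 0"
proof (induction m)
  case 0
  then show ?case by (simp add: walk_abs_mean_def)
next
  case (Suc m)
  have "walk_abs_mean (2 * Suc m + 1) 0
      = walk_abs_mean (2 * m + 1) 0 + walk_prob (Suc (2 * m)) 0 + walk_prob (2 * Suc m) 0"
    by (simp add: walk_abs_mean_def del: walk_prob.simps)
  also have "\<dots> = real (2 * m + 2) * walk_prob (2 * Suc m) 0 + walk_prob (2 * Suc m) 0"
    unfolding Suc walk_prob_Suc_even_0 walk_prob_even_0_Suc by simp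
  finally show ?case by (simp add: algebra_simps del: walk_prob.simps)
qed

lemma walk_abs_mean_Suc_odd: "walk_abs_mean (2 * m + 2) 0 = walk_abs_mean (2 * m + 1) 0"
proof -
  have "walk_abs_mean (2 * m + 2) 0 = walk_abs_mean (2 * m + 1) 0 + walk_prob (Suc (2 * m)) 0"
    by (simp add: walk_abs_mean_def del: walk_prob.simps)
  then show ?thesis by (simp add: walk_prob_Suc_even_0 del: walk_prob.simps)
qed

lemma walk_abs_mean_even: "walk_abs_mean (2 * m) 0 = real (2 * m) * walk_prob (2 * m) 0"
proof (cases m)
  case (Suc k)
  have "walk_abs_mean (2 * m) 0 = real (2 * k + 1) * walk_prob (2 * k) 0"
    using walk_abs_mean_Suc_odd[of k] walk_abs_mean_odd[of k] Suc by simp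
  then show ?thesis
    using walk_prob_even_0_Suc[of k] Suc by simp
qed simp

text \<open>This is E|S| \<ge> sqrt (n / 2) at n = 2m. With p the return probability, 4 m p^2 equals
  1 at m = 1, and passing to m + 1 multiplies it by (2m + 1)^2 / (4m (m + 1)) > 1.\<close>

lemma walk_prob_even_0_ge:
  assumes "m > 0"
  shows "1 \<le> 2 * sqrt (real m) * walk_prob (2 * m) 0"
proof -
  have sq: "1 \<le> 4 * real m * (walk_prob (2 * m) 0)\<^sup>2"
    using assms
  proof (induction m rule: nat_induct_non_zero)
    case 1
    have "walk_prob (2 * 1) 0 = 1 / 2"
      unfolding walk_prob_even_0 by simp
    then show ?case by (simp only: power2_eq_square)
  next
    case (Suc m)
    let ?b = "walk_prob (2 * m) 0" and ?b' = "walk_prob (2 * Suc m) 0"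
    have "4 * real m * real (Suc m) \<le> 1 * (real (2 * m + 1))\<^sup>2"
      by (simp add: power2_eq_square algebra_simps)
    also have "\<dots> \<le> (4 * real m * ?b\<^sup>2) * (real (2 * m + 1))\<^sup>2"
      using Suc.IH by (intro mult_right_mono) auto
    also have "\<dots> = 4 * real m * (real (2 * m + 2) * ?b')\<^sup>2"
      unfolding walk_prob_even_0_Suc by (simp add: power_mult_distrib)
    finally have "(4 * real m * real (Suc m)) * 1
        \<le> (4 * real m * real (Suc m)) * (4 * real (Suc m) * ?b'\<^sup>2)"
      by (simp add: power2_eq_square algebra_simps del: walk_prob.simps)
    then show ?case
      using Suc.hyps by (simp del: walk_prob.simps)
  qed
  have "(2 * sqrt (real m) * walk_prob (2 * m) 0)\<^sup>2 = 4 * real m * (walk_prob (2 * m) 0)\<^sup>2"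
    by (simp add: power_mult_distrib)
  moreover have "0 \<le> 2 * sqrt (real m) * walk_prob (2 * m) 0"
    by (simp add: walk_prob_even_0)
  ultimately show ?thesis
    using sq by (metis power2_le_imp_le one_power2)
qed

text \<open>Blocks of unequal length lose nothing: between consecutive integers \<open>n\<close> the mean
  \<open>E\<bar>S\<^sub>n\<bar>\<close> is interpolated either by a constant or by a line through the origin,
  and both stay above \<open>sqrt (x / 2)\<close>.\<close>

lemma sum_walk_abs_mean_ge:
  fixes r :: "nat \<Rightarrow> nat"
  assumes n: "n > 0" and r: "\<And>j. j < V \<Longrightarrow> r j = n \<or> r j = Suc n"
    and T: "(\<Sum>j<V. r j) = T"
  shows "sqrt (real V * real T / 2) \<le> (\<Sum>j<V. walk_abs_mean (r j) 0)"
proof (cases "even n")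
  case True
  then obtain m where m: "n = 2 * m" "m > 0" using n by (auto elim: evenE)
  have b: "1 \<le> 2 * sqrt (real m) * walk_prob n 0"
    using walk_prob_even_0_ge m by simp
  \<comment> \<open>For even \<open>n\<close> both block lengths have the same slope, so the total
    is linear in \<open>T\<close>; then \<open>T\<close> \<ge> 2mV gives the bound.\<close>
  have lin: "walk_abs_mean (r j) 0 = real (r j) * walk_prob n 0" if "j < V" for j
    using r[OF that] walk_abs_mean_even[of m] walk_abs_mean_odd[of m] m by auto
  have "V * n \<le> T"
  proof -
    have "(\<Sum>j<V. n) \<le> (\<Sum>j<V. r j)"
      by (intro sum_mono) (use r in force)
    then show ?thesis using T by simp
  qed
  then have VT: "real V * (2 * real m) \<le> real T"
    using m by (metis of_nat_le_iff of_nat_mult of_nat_numeral)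
  have "(\<Sum>j<V. walk_abs_mean (r j) 0) = real T * walk_prob n 0"
    using lin T by (simp flip: sum_distrib_right of_nat_sum)
  moreover have "sqrt (real V * real T / 2) \<le> real T * walk_prob n 0"
  proof (rule real_le_lsqrt)
    show "0 \<le> real T * walk_prob n 0"
      using m by (simp add: walk_prob_even_0)
    have "1 \<le> (2 * sqrt (real m) * walk_prob n 0)\<^sup>2"
      using b by simp
    then have b2: "1 \<le> 4 * real m * (walk_prob n 0)\<^sup>2"
      by (simp add: power_mult_distrib)
    have "real V * real T * (4 * real m) \<le> 2 * (real T)\<^sup>2 * 1"
      using mult_right_mono[OF VT, of "2 * real T"] by (simp add: power2_eq_square algebra_simps)
    also have "\<dots> \<le> 2 * (real T)\<^sup>2 * (4 * real m * (walk_prob n 0)\<^sup>2)"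
      using b2 by (intro mult_left_mono) auto
    finally show "real V * real T / 2 \<le> (real T * walk_prob n 0)\<^sup>2"
      using m(2) by (simp add: power_mult_distrib mult_ac)
  qed
  ultimately show ?thesis by simp
next
  case False
  then obtain k where k: "n = 2 * k + 1" by (auto elim: oddE)
  define m where "m = Suc k"
  \<comment> \<open>For odd \<open>n\<close> both block lengths \<open>n\<close> and
    \<open>n + 1 = 2 * m\<close> have the same mean; here \<open>T\<close> \<le> 2mV is the
    direction needed.\<close>
  have const: "walk_abs_mean (r j) 0 = walk_abs_mean (2 * m) 0" if "j < V" for j
    using r[OF that] walk_abs_mean_Suc_odd[of k] k by (auto simp: m_def)
  have "sqrt (real m) * 1 \<le> sqrt (real m) * (2 * sqrt (real m) * walk_prob (2 * m) 0)"
    by (intro mult_left_mono walk_prob_even_0_ge) (auto simp: m_def)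
  also have "\<dots> = walk_abs_mean (2 * m) 0"
    unfolding walk_abs_mean_even by (simp flip: mult.assoc add: mult.commute)
  finally have am: "sqrt (real m) \<le> walk_abs_mean (2 * m) 0" by simp
  have "T \<le> V * (2 * m)"
  proof -
    have "(\<Sum>j<V. r j) \<le> (\<Sum>j<V. 2 * m)"
      by (intro sum_mono) (use r k in \<open>force simp: m_def\<close>)
    then show ?thesis using T by simp
  qed
  then have VT: "real T \<le> real V * (2 * real m)"
    by (metis of_nat_le_iff of_nat_mult of_nat_numeral)
  have "sqrt (real V * real T / 2) \<le> sqrt ((real V)\<^sup>2 * real m)"
    using mult_left_mono[OF VT, of "real V"] by (simp add: power2_eq_square algebra_simps)
  also have "\<dots> = real V * sqrt (real m)"
    by (simp add: real_sqrt_mult)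
  also have "\<dots> \<le> real V * walk_abs_mean (2 * m) 0"
    using am by (intro mult_left_mono) auto
  also have "\<dots> = (\<Sum>j<V. walk_abs_mean (r j) 0)"
    using const by simp
  finally show ?thesis .
qed

section \<open>Round counts of the residue classes and the greedy choice of signs\<close>

text \<open>Cyclic assignment balances the blocks: their lengths differ by at most one, as
  \<open>sum_walk_abs_mean_ge\<close> requires.\<close>

lemma card_residue_class_lessThan:
  fixes V :: nat
  assumes "j < V"
  shows "card {u. u < T \<and> u mod V = j} = T div V + (if j < T mod V then 1 else 0)"
proof (induction T)
  case 0
  then show ?case by simp
next
  case (Suc T)
  have "{u. u < Suc T \<and> u mod V = j}
      = {u. u < T \<and> u mod V = j} \<union> (if T mod V = j then {T} else {})"
    by (auto simp: less_Suc_eq)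
  then have "card {u. u < Suc T \<and> u mod V = j}
      = card {u. u < T \<and> u mod V = j} + (if T mod V = j then 1 else 0)"
    by (auto simp: card_insert_if)
  then show ?case
    using Suc assms by (auto simp: div_Suc mod_Suc)
qed

lemma sum_card_residue_class_lessThan:
  fixes V :: nat
  assumes "V > 0"
  shows "(\<Sum>j<V. card {u. u < T \<and> u mod V = j}) = T"
proof -
  have "(\<Sum>j<V. card {u. u < T \<and> u mod V = j}) = card (\<Union>j<V. {u. u < T \<and> u mod V = j})"
    by (subst card_UN_disjoint) auto
  also have "(\<Union>j<V. {u. u < T \<and> u mod V = j}) = {..<T}"
    using assms by auto
  finally show ?thesis by simp
qed

text \<open>The adversary's strategy: one of the two signs keeps the current loss plus the expected
  final value of \<open>\<bar>S\<bar>\<close>, summed over the classes, from decreasing.\<close>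

lemma greedy_signs:
  fixes a :: "(nat \<Rightarrow> int) \<Rightarrow> nat \<Rightarrow> real" and blk :: "nat \<Rightarrow> nat" and T :: nat
  assumes local: "\<And>\<sigma> \<tau> t. (\<And>u. u < t \<Longrightarrow> \<sigma> u = \<tau> u) \<Longrightarrow> a \<sigma> t = a \<tau> t"
    and blk: "\<And>u. blk u < V"
  shows "\<exists>\<sigma>. (\<forall>u. \<sigma> u \<in> {1, -1}) \<and>
    (\<Sum>j<V. walk_abs_mean (card {u. u < T \<and> blk u = j}) 0)
      \<le> (\<Sum>u<T. \<sigma> u * a \<sigma> u) + (\<Sum>j<V. \<bar>\<Sum>u<T. if blk u = j then real_of_int (\<sigma> u) else 0\<bar>)"
proof -
  \<comment> \<open>\<open>rem t j\<close> counts the rounds of block \<open>j\<close> still to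
    come, so \<Phi> is the signed loss so far plus the conditional expectation of the final absolute
    sums.\<close>
  define rem where "rem t j = card {u. t \<le> u \<and> u < T \<and> blk u = j}" for t j
  define S where "S \<sigma> t j = (\<Sum>u<t. if blk u = j then \<sigma> u else 0)" for \<sigma> :: "nat \<Rightarrow> int" and t j
  define \<Phi> where "\<Phi> \<sigma> t = (\<Sum>u<t. \<sigma> u * a \<sigma> u) + (\<Sum>j<V. walk_abs_mean (rem t j) (S \<sigma> t j))"
    for \<sigma> t
  have rem_Suc: "rem t j = (if j = blk t then Suc (rem (Suc t) j) else rem (Suc t) j)"
    if "t < T" for t j
  proof -
    have "{u. t \<le> u \<and> u < T \<and> blk u = j} = (if j = blk t then
        insert t {u. Suc t \<le> u \<and> u < T \<and> blk u = j} else {u. Suc t \<le> u \<and> u < T \<and> blk u = j})"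
      using that by (auto simp: le_less Suc_le_eq)
    then show ?thesis by (simp add: rem_def)
  qed
  have "\<exists>\<sigma>. (\<forall>u. \<sigma> u \<in> {1, -1}) \<and> (\<Sum>j<V. walk_abs_mean (rem 0 j) 0) \<le> \<Phi> \<sigma> t" if "t \<le> T" for t
    using that
  proof (induction t)
    case 0
    show ?case
      \<comment> \<open>No sign counts yet at time 0, so any sequence serves.\<close>
      by (rule exI[of _ "\<lambda>_. 1"]) (simp add: \<Phi>_def S_def)
  next
    case (Suc t)
    then obtain \<sigma> where \<sigma>: "\<And>u. \<sigma> u \<in> {1, -1}"
      and IH: "(\<Sum>j<V. walk_abs_mean (rem 0 j) 0) \<le> \<Phi> \<sigma> t" by auto
    let ?b = "blk t"
    let ?c = "S \<sigma> t ?b" and ?n = "rem (Suc t) ?b"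
    \<comment> \<open>The right-hand sides for the two signs average to the left-hand side: the
      terms in \<open>a\<close> cancel. Hence one of them is at least as large.\<close>
    have "\<exists>e \<in> {1, -1 :: int}. walk_abs_mean (Suc ?n) ?c \<le> e * a \<sigma> t + walk_abs_mean ?n (?c + e)"
      unfolding walk_abs_mean_Suc[of ?n ?c] by simp argo
    then obtain e :: int where e: "e \<in> {1, -1}"
      and step: "walk_abs_mean (Suc ?n) ?c \<le> e * a \<sigma> t + walk_abs_mean ?n (?c + e)" by blast
    define \<tau> where "\<tau> = \<sigma>(t := e)"
    \<comment> \<open>By locality the coefficient of round \<open>t\<close> itself is also
      unaffected by the sign chosen there.\<close>
    have a_eq: "a \<tau> u = a \<sigma> u" if "u \<le> t" for u
      using that by (intro local) (auto simp: \<tau>_def)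
    have S_eq: "S \<tau> (Suc t) j = (if j = ?b then S \<sigma> t j + e else S \<sigma> t j)" for j
      by (auto simp: S_def \<tau>_def intro!: sum.cong)
    have "(\<Sum>u<Suc t. \<tau> u * a \<tau> u) = (\<Sum>u<t. \<sigma> u * a \<sigma> u) + e * a \<sigma> t"
      using a_eq by (auto simp: \<tau>_def intro!: sum.cong)
    moreover have "(\<Sum>j<V. walk_abs_mean (rem (Suc t) j) (S \<tau> (Suc t) j))
        = walk_abs_mean ?n (?c + e)
          + (\<Sum>j\<in>{..<V} - {?b}. walk_abs_mean (rem (Suc t) j) (S \<sigma> t j))"
      using blk by (subst sum.remove[of _ ?b]) (auto simp: S_eq)
    moreover have "(\<Sum>j<V. walk_abs_mean (rem t j) (S \<sigma> t j))
        = walk_abs_mean (Suc ?n) ?c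
          + (\<Sum>j\<in>{..<V} - {?b}. walk_abs_mean (rem (Suc t) j) (S \<sigma> t j))"
      using blk rem_Suc[of t] Suc.prems by (subst sum.remove[of _ ?b]) auto
    ultimately have "\<Phi> \<sigma> t \<le> \<Phi> \<tau> (Suc t)"
      using step unfolding \<Phi>_def by simp
    moreover have "\<tau> u \<in> {1, -1}" for u
      using \<sigma> e by (auto simp: \<tau>_def)
    ultimately show ?case using IH by (intro exI[of _ \<tau>]) auto
  qed
  from this[of T] obtain \<sigma> where \<sigma>: "\<forall>u. \<sigma> u \<in> {1, -1}"
    and le: "(\<Sum>j<V. walk_abs_mean (rem 0 j) 0) \<le> \<Phi> \<sigma> T" by auto
  \<comment> \<open>With no rounds left, each conditional expectation is the absolute value
    itself.\<close>
  have rem_T: "rem T j = 0" for j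
    by (auto simp: rem_def)
  have "real_of_int (S \<sigma> T j) = (\<Sum>u<T. if blk u = j then real_of_int (\<sigma> u) else 0)" for j
    by (auto simp: S_def intro!: sum.cong)
  then have "\<Phi> \<sigma> T = (\<Sum>u<T. \<sigma> u * a \<sigma> u)
      + (\<Sum>j<V. \<bar>\<Sum>u<T. if blk u = j then real_of_int (\<sigma> u) else 0\<bar>)"
    by (simp add: \<Phi>_def rem_T)
  then show ?thesis
    using \<sigma> le by (intro exI[of _ \<sigma>]) (simp add: rem_def)
qed

section \<open>Rank from an independent spanning set of columns\<close>

context vec_space
begin

text \<open>Any further column already lies in the span of \<open>U\<close>, so adding it destroys
  independence and \<open>U\<close> is maximal.\<close>

lemma rank_eq_card_indpt_spanning:
  assumes A: "A \<in> carrier_mat n nc" and U: "U \<subseteq> set (cols A)" "lin_indpt U"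
    and span: "set (cols A) \<subseteq> span U"
  shows "rank A = card U"
proof (rule rank_card_indpt[OF A])
  have carr: "set (cols A) \<subseteq> carrier_vec n"
    using A cols_dim by blast
  have "B = U" if B: "U \<subseteq> B" "B \<subseteq> set (cols A)" "lin_indpt B" for B
  proof (rule ccontr)
    assume "B \<noteq> U"
    with B obtain w where w: "w \<in> B" "w \<notin> U" by auto
    have "w \<in> span (B - {w})"
      using span w B span_is_monotone[of U "B - {w}"] by blast
    then have "lin_dep B"
      using lindep_span[of B] B carr w finite_subset[OF B(2)] by auto
    with B show False by simp
  qed
  then show "maximal U (\<lambda>T. T \<subseteq> set (cols A) \<and> lin_indpt T)"
    using U by (auto simp: maximal_def)
qed

text \<open>Coefficients on vectors become coefficients on indices; injectivity keeps two indices
  from sharing a vector.\<close>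

lemma lin_indpt_image:
  assumes fin: "finite I" and carr: "v ` I \<subseteq> carrier_vec n" and inj: "inj_on v I"
    and indpt: "\<And>c j. (\<And>i. i < n \<Longrightarrow> (\<Sum>j\<in>I. c j * v j $ i) = 0) \<Longrightarrow> j \<in> I \<Longrightarrow> c j = 0"
  shows "lin_indpt (v ` I)"
proof (rule finite_lin_indpt2)
  fix a assume 0: "lincomb a (v ` I) = 0\<^sub>v n"
  have "(\<Sum>j\<in>I. a (v j) * v j $ i) = 0" if "i < n" for i
    using lincomb_index[OF that carr, of a] that
    by (simp add: 0 sum.reindex[OF inj])
  then have "a (v j) = 0" if "j \<in> I" for j
    using that by (rule indpt)
  then show "\<forall>w\<in>v ` I. a w = 0"
    by simp
qed (use fin carr in auto)

end

section \<open>The sign vectors given by the bits of the expert index\<close>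

text \<open>Every pattern of \<open>V\<close> signs occurs at exactly one of the first
  \<open>2 ^ V\<close> experts; zeros at the others fix the support size.\<close>

definition rademacher_vec :: "nat \<Rightarrow> nat \<Rightarrow> nat \<Rightarrow> real vec" where
  "rademacher_vec N V j = vec N (\<lambda>i. if i < 2 ^ V then (if bit i j then - 1 else 1) else 0)"

lemma rademacher_vec_carrier [simp]: "rademacher_vec N V j \<in> carrier_vec N"
  and dim_rademacher_vec [simp]: "dim_vec (rademacher_vec N V j) = N"
  by (simp_all add: rademacher_vec_def)

text \<open>Experts 0 and \<open>2 ^ k\<close> differ only in bit \<open>k\<close>, so subtracting
  their two equations leaves \<open>2 * c k = 0\<close>.\<close>

lemma rademacher_vec_indpt:
  assumes N: "2 ^ V \<le> N" and k: "k < V"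
    and zero: "\<And>i. i < N \<Longrightarrow> (\<Sum>j<V. c j * rademacher_vec N V j $ i) = 0"
  shows "c k = 0"
proof -
  have kV: "2 ^ k < (2 :: nat) ^ V" using k by simp
  have "(\<Sum>j<V. c j) = 0"
    using zero[of 0] N by (simp add: rademacher_vec_def less_le_trans[of 0 "2 ^ V"])
  moreover have "(\<Sum>j<V. c j * rademacher_vec N V j $ (2 ^ k)) = (\<Sum>j<V. c j - (if j = k then 2 * c j else 0))"
    using less_le_trans[OF kV N] kV by (intro sum.cong) (auto simp: rademacher_vec_def bit_exp_iff)
  moreover have "(\<Sum>j<V. c j * rademacher_vec N V j $ (2 ^ k)) = 0"
    using zero[of "2 ^ k"] kV N by simp
  ultimately show ?thesis
    using k by (simp add: sum_subtractf)
qed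

lemma ex_nat_with_bits: "\<exists>i < 2 ^ V. \<forall>j<V. bit (i :: nat) j \<longleftrightarrow> P j"
proof (intro exI conjI allI impI)
  show "horner_sum of_bool 2 (map P [0..<V]) < (2 :: nat) ^ V"
    by (metis horner_sum_of_bool_2_less length_map length_upt minus_nat.diff_0)
qed (simp add: bit_horner_sum_bit_iff)

section \<open>The adversarial loss sequence, its rank and its regret\<close>

theorem theorem13:
  fixes V N T :: nat and s :: real and alg :: "real vec list \<Rightarrow> real vec"
  assumes "V > 0" and "2 ^ V \<le> N" and "s > 0" and "V \<le> T"
    and "online_algorithm N T alg"
  shows "\<exists>l :: nat \<Rightarrow> real vec.
           (\<forall>t\<in>{1..T}. l t \<in> carrier_vec N \<and> (\<forall>i<N. l t $ i \<in> {0, s, - s})) \<and>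
           vec_space.rank N (loss_matrix N T l) = V \<and>
           (\<forall>t\<in>{1..T}. norm0 (l t) = 2 ^ V) \<and>
           regret N T alg l \<ge> 2 * s * sqrt (real V * real T / 8)"
proof -
  interpret vec_space "TYPE(real)" N .
  let ?x = "rademacher_vec N V"
  \<comment> \<open>Rounds count from 1 but signs from 0, hence \<open>t - 1\<close>. Below,
    \<open>a\<close> is the learner's loss in round \<open>u + 1\<close> without its sign and
    scale.\<close>
  define L where "L \<sigma> t = (s * real_of_int (\<sigma> (t - 1))) \<cdot>\<^sub>v ?x ((t - 1) mod V)"
    for \<sigma> :: "nat \<Rightarrow> int" and t
  define a where "a \<sigma> u = play alg (L \<sigma>) (Suc u) \<bullet> ?x (u mod V)" for \<sigma> u
  \<comment> \<open>The play in round \<open>t + 1\<close> sees only the losses of rounds 1 to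
    \<open>t\<close>, which use the signs below \<open>t\<close>.\<close>
  have local: "a \<sigma> t = a \<tau> t" if "\<And>u. u < t \<Longrightarrow> \<sigma> u = \<tau> u" for \<sigma> \<tau> t
  proof -
    have "map (L \<sigma>) [1..<Suc t] = map (L \<tau>) [1..<Suc t]"
      using that by (intro map_cong) (auto simp: L_def)
    then show ?thesis by (simp only: a_def play_def)
  qed
  define r where "r j = card {u. u < T \<and> u mod V = j}" for j
  obtain \<sigma> where sgn: "\<And>u. \<sigma> u \<in> {1, -1}"
    and greedy: "(\<Sum>j<V. walk_abs_mean (r j) 0) \<le> (\<Sum>u<T. \<sigma> u * a \<sigma> u)
      + (\<Sum>j<V. \<bar>\<Sum>u<T. if u mod V = j then real_of_int (\<sigma> u) else 0\<bar>)"
    using greedy_signs[where a = a and blk = "\<lambda>u. u mod V" and V = V and T = T, OF local] \<open>V > 0\<close>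
    unfolding r_def by auto
  define l where "l = L \<sigma>"
  define S where "S j = (\<Sum>u<T. if u mod V = j then real_of_int (\<sigma> u) else 0)" for j
  have l_carr: "l t \<in> carrier_vec N" for t
    by (simp add: l_def L_def)
  have l_index: "l t $ i = s * \<sigma> (t - 1) * ?x ((t - 1) mod V) $ i" if "i < N" for t i
    using that by (simp add: l_def L_def)
  have l_Suc: "l (Suc u) = (s * \<sigma> u) \<cdot>\<^sub>v ?x (u mod V)" for u
    by (simp add: l_def L_def)
  have entries: "l t $ i \<in> {0, s, - s}" if "i < N" for t i
    using that sgn[of "t - 1"] unfolding l_index[OF that] by (auto simp: rademacher_vec_def)
  have norm: "norm0 (l t) = 2 ^ V" for t
  proof -
    have "{i. i < dim_vec (l t) \<and> l t $ i \<noteq> 0} = {..<2 ^ V}"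
      using sgn[of "t - 1"] \<open>2 ^ V \<le> N\<close> \<open>s > 0\<close> carrier_vecD[OF l_carr[of t]]
      by (auto simp: l_index rademacher_vec_def split: if_splits)
    then show ?thesis by (simp add: norm0_def)
  qed

  \<comment> \<open>The first \<open>V\<close> losses, all present since \<open>V\<close> \<le>
    \<open>T\<close>, are nonzero multiples of the independent sign vectors; later losses repeat
    them up to sign.\<close>
  have rank: "rank (loss_matrix N T l) = V"
  proof -
    let ?A = "loss_matrix N T l"
    let ?v = "\<lambda>j. l (Suc j)"
    let ?U = "?v ` {..<V}"
    have A: "?A \<in> carrier_mat N T"
      by (auto simp: loss_matrix_def)
    have cols: "set (cols ?A) = (\<lambda>u. l (Suc u)) ` {..<T}"
    proof -
      have "set (cols ?A) = l ` {1..<Suc T}"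
        unfolding loss_matrix_def by (subst cols_mat_of_cols) (use l_carr in auto)
      also have "{1..<Suc T} = Suc ` {..<T}"
        by (simp add: lessThan_atLeast0)
      finally show ?thesis by (simp add: image_image)
    qed
    have indpt: "c k = 0" if zero: "\<And>i. i < N \<Longrightarrow> (\<Sum>j<V. c j * ?v j $ i) = 0" and k: "k < V" for c k
    proof -
      have "c k * (s * \<sigma> k) = 0"
        using \<open>2 ^ V \<le> N\<close> k
      proof (rule rademacher_vec_indpt)
        fix i assume "i < N"
        then show "(\<Sum>j<V. c j * (s * \<sigma> j) * ?x j $ i) = 0"
          using zero[of i] by (simp add: l_index mult.assoc)
      qed
      then show ?thesis using sgn[of k] \<open>s > 0\<close> by auto
    qed
    have inj: "inj_on ?v {..<V}"
    proof (rule inj_onI, rule ccontr)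
      fix j k assume jk: "j \<in> {..<V}" "k \<in> {..<V}" "?v j = ?v k" "j \<noteq> k"
      \<comment> \<open>Two equal vectors would satisfy the relation with coefficients 1 and -1,
        contradicting \<open>indpt\<close>.\<close>
      have "(\<Sum>m<V. ((if m = j then 1 else 0) - (if m = k then 1 else 0)) * ?v m $ i) = 0" for i
        using jk by (simp add: left_diff_distrib sum_subtractf if_distrib[of "\<lambda>z. z * _"] cong: if_cong)
      from indpt[of "\<lambda>m. (if m = j then 1 else 0) - (if m = k then 1 else 0)", OF this, of j]
      show False using jk by simp
    qed
    have "lin_indpt ?U"
    proof (rule lin_indpt_image[OF _ _ inj])
      show "c k = 0" if "\<And>i. i < N \<Longrightarrow> (\<Sum>j<V. c j * ?v j $ i) = 0" "k \<in> {..<V}" for c k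
        using indpt[OF that(1)] that(2) by simp
    qed (use l_carr in auto)
    moreover have "set (cols ?A) \<subseteq> span ?U"
    proof
      fix w assume "w \<in> set (cols ?A)"
      then obtain u where u: "w = l (Suc u)" unfolding cols by auto
      let ?j = "u mod V"
      have "?v ?j \<in> span ?U"
        by (rule subsetD[OF in_own_span]) (use l_carr \<open>V > 0\<close> in auto)
      \<comment> \<open>The sign of \<open>?v ?j\<close> squares to 1, which leaves the sign of
        round \<open>u + 1\<close>.\<close>
      then have "(\<sigma> u * \<sigma> ?j) \<cdot>\<^sub>v ?v ?j \<in> span ?U"
        using l_carr by (intro smult_in_span) auto
      moreover have "(\<sigma> u * \<sigma> ?j) \<cdot>\<^sub>v ?v ?j = w"
        using sgn[of ?j] unfolding u l_Suc by (auto simp: smult_smult_assoc)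
      ultimately show "w \<in> span ?U" by simp
    qed
    moreover have "?U \<subseteq> set (cols ?A)"
      using \<open>V \<le> T\<close> unfolding cols by auto
    ultimately have "rank ?A = card ?U"
      using rank_eq_card_indpt_spanning[OF A] by blast
    then show ?thesis using card_image[OF inj] by simp
  qed

  have shift: "(\<Sum>t=1..T. f t) = (\<Sum>u<T. f (Suc u))" for f :: "nat \<Rightarrow> real"
    by (simp add: sum.shift_bounds_cl_Suc_ivl sum.atLeast1_atMost_eq)
  have loss: "(\<Sum>t=1..T. play alg l t \<bullet> l t) = s * (\<Sum>u<T. \<sigma> u * a \<sigma> u)"
    unfolding shift sum_distrib_left
    by (intro sum.cong) (auto simp: l_Suc a_def l_def[symmetric] scalar_prod_def sum_distrib_left mult_ac)
  \<comment> \<open>A set bit means entry -1, so bit \<open>j\<close> is set when \<open>S j\<close>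
    is positive and block \<open>j\<close> costs this expert \<open>- s * \<bar>S j\<bar>\<close>;
    for \<open>S j = 0\<close> either bit would do.\<close>
  obtain i :: nat where i: "i < 2 ^ V" "\<And>j. j < V \<Longrightarrow> bit i j \<longleftrightarrow> 0 < S j"
    using ex_nat_with_bits[of V "\<lambda>j. 0 < S j"] by auto
  have iN: "i < N" using i(1) \<open>2 ^ V \<le> N\<close> by simp
  have best: "(\<Sum>t=1..T. l t $ i) = - s * (\<Sum>j<V. \<bar>S j\<bar>)"
  proof -
    \<comment> \<open>The inner sum has a single nonzero term, at the block of round
      \<open>u + 1\<close>; swapping the sums groups the rounds by block.\<close>
    have "(\<Sum>t=1..T. l t $ i) = (\<Sum>u<T. \<Sum>j<V. if u mod V = j then s * \<sigma> u * ?x j $ i else 0)"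
      unfolding shift using iN \<open>V > 0\<close> by (simp add: l_index)
    also have "\<dots> = (\<Sum>j<V. \<Sum>u<T. if u mod V = j then s * \<sigma> u * ?x j $ i else 0)"
      by (rule sum.swap)
    also have "\<dots> = (\<Sum>j<V. s * (?x j $ i * S j))"
      unfolding S_def sum_distrib_left by (intro sum.cong) auto
    also have "\<dots> = (\<Sum>j<V. - s * \<bar>S j\<bar>)"
      using i iN by (intro sum.cong) (auto simp: rademacher_vec_def)
    finally show ?thesis by (simp add: sum_distrib_left)
  qed
  have "(MIN i\<in>{..<N}. \<Sum>t=1..T. l t $ i) \<le> - s * (\<Sum>j<V. \<bar>S j\<bar>)"
    unfolding best[symmetric] using iN by (intro Min_le) auto
  then have "regret N T alg l \<ge> s * ((\<Sum>u<T. \<sigma> u * a \<sigma> u) + (\<Sum>j<V. \<bar>S j\<bar>))"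
    unfolding regret_def loss by (simp add: algebra_simps)
  moreover have "sqrt (real V * real T / 2) \<le> (\<Sum>j<V. walk_abs_mean (r j) 0)"
  proof (rule sum_walk_abs_mean_ge)
    show "T div V > 0"
      using \<open>V > 0\<close> \<open>V \<le> T\<close> by (simp add: div_greater_zero_iff)
    show "(\<Sum>j<V. r j) = T"
      unfolding r_def using \<open>V > 0\<close> by (rule sum_card_residue_class_lessThan)
  qed (simp add: r_def card_residue_class_lessThan)
  then have "s * sqrt (real V * real T / 2) \<le> s * ((\<Sum>u<T. \<sigma> u * a \<sigma> u) + (\<Sum>j<V. \<bar>S j\<bar>))"
    using greedy \<open>s > 0\<close> unfolding S_def by (intro mult_left_mono) auto
  moreover have "2 * s * sqrt (real V * real T / 8) = s * sqrt (real V * real T / 2)"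
  proof -
    have "sqrt (real V * real T / 2) = sqrt (4 * (real V * real T / 8))" by simp
    also have "\<dots> = 2 * sqrt (real V * real T / 8)"
      unfolding real_sqrt_mult by simp
    finally show ?thesis by simp
  qed
  ultimately have "2 * s * sqrt (real V * real T / 8) \<le> regret N T alg l"
    by linarith
  with l_carr entries norm rank show ?thesis
    by (intro exI[of _ l] conjI ballI allI impI)
qed

end
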